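(* Let $c_1=c_2=c$. The stability region for $\alpha=1/2$ is a proper subset of that for $\alpha=1/3$: with $S_{1/2}$ and $S_{1/3}$ the subsets of $\{(c,k_1,k_2)\in\mathbb{R}^3 : c>0,\,k_1>0,\,k_2>0\}$ defined in the context, $S_{1/2}\subsetneq S_{1/3}$.
   Context: For $\alpha\in(0,1)$ put $\beta=\alpha/(1-\alpha)$. With identical marginal costs $c_1=c_2=c>0$ and adjustment speeds $k_1,k_2>0$, the dynamic Bertrand duopoly game is the iteration of the map $$F_\alpha(p_1,p_2)=\left(p_1+k_1\frac{-\beta p_2^{\beta}p_1^{1+\beta}+\left(p_2^{2\beta}+(1+\beta)p_1^{\beta}p_2^{\beta}\right)c}{p_1^2(p_1^\beta+p_2^\beta)^2},\;\; p_2+k_2\frac{-\beta p_1^{\beta}p_2^{1+\beta}+\left(p_1^{2\beta}+(1+\beta)p_1^{\beta}p_2^{\beta}\right)c}{p_2^2(p_1^\beta+p_2^\beta)^2}\right),\qquad p_1,p_2>0.$$ For $\alpha=1/2$ ($\beta=1$) its unique fixed point with positive coordinates is $(3c,3c)$; for $\alpha=1/3$ ($\beta=1/2$) it is $(5c,5c)$. For $\alpha\in\{1/2,1/3\}$ the stability region $S_\alpha$ is the set of all $(c,k_1,k_2)$ with $c,k_1,k_2>0$ for which this fixed point is locally stable, i.e. both eigenvalues of the Jacobian matrix $J$ of $F_\alpha$ at the fixed point have modulus $<1$; equivalently (Jury criterion) $1-\mathrm{Tr}(J)+\mathrm{Det}(J)>0$, $1+\mathrm{Tr}(J)+\mathrm{Det}(J)>0$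 and $1-\mathrm{Det}(J)>0$. *)

theory Defs
  imports "HOL-Analysis.Analysis"
begin

definition bertrand_beta :: "real \<Rightarrow> real" where
  "bertrand_beta \<alpha> = \<alpha> / (1 - \<alpha>)"

text \<open>Adjustment direction of a firm with price \<open>p\<close> facing the competitor's price \<open>q\<close>.
  Only \<open>p, q > 0\<close> is meaningful.\<close>

definition bertrand_marginal :: "real \<Rightarrow> real \<Rightarrow> real \<Rightarrow> real \<Rightarrow> real" where
  "bertrand_marginal \<alpha> c p q =
    (let \<beta> = bertrand_beta \<alpha> in
      (- \<beta> * q powr \<beta> * p powr (1 + \<beta>)
        + (q powr (2 * \<beta>) + (1 + \<beta>) * p powr \<beta> * q powr \<beta>) * c)
      / (p\<^sup>2 * (p powr \<beta> + q powr \<beta>)\<^sup>2))"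

definition bertrand_map :: "real \<Rightarrow> real \<Rightarrow> real \<Rightarrow> real \<Rightarrow> real^2 \<Rightarrow> real^2" where
  "bertrand_map \<alpha> c k1 k2 p =
    vector [p $ 1 + k1 * bertrand_marginal \<alpha> c (p $ 1) (p $ 2),
            p $ 2 + k2 * bertrand_marginal \<alpha> c (p $ 2) (p $ 1)]"

definition positive_fixed_point :: "(real^2 \<Rightarrow> real^2) \<Rightarrow> real^2 \<Rightarrow> bool" where
  "positive_fixed_point F p \<longleftrightarrow> 0 < p $ 1 \<and> 0 < p $ 2 \<and> F p = p"

definition bertrand_equilibrium :: "real \<Rightarrow> real \<Rightarrow> real \<Rightarrow> real \<Rightarrow> real^2" where
  "bertrand_equilibrium \<alpha> c k1 k2 = (THE p. positive_fixed_point (bertrand_map \<alpha> c k1 k2) p)"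

definition is_eigenvalue :: "'a::field^'n^'n \<Rightarrow> 'a \<Rightarrow> bool" where
  "is_eigenvalue A \<mu> \<longleftrightarrow> (\<exists>v. v \<noteq> 0 \<and> A *v v = \<mu> *s v)"

text \<open>The eigenvalues of the real Jacobian matrix are taken over the complex numbers.\<close>

definition locally_stable :: "(real^'n \<Rightarrow> real^'n) \<Rightarrow> real^'n \<Rightarrow> bool" where
  "locally_stable F p \<longleftrightarrow>
    (\<forall>\<mu>. is_eigenvalue (map_matrix complex_of_real (jacobian F (at p))) \<mu> \<longrightarrow> cmod \<mu> < 1)"

definition stability_region :: "real \<Rightarrow> (real \<times> real \<times> real) set" where
  "stability_region \<alpha> =
    {(c, k1, k2). 0 < c \<and> 0 < k1 \<and> 0 < k2 \<and>
      locally_stable (bertrand_map \<alpha> c k1 k2) (bertrand_equilibrium \<alpha> c k1 k2)}"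

text \<open>The definite description above is well defined in the two relevant cases.\<close>

lemma positive_fixed_point_iff:
  assumes "k1 > 0" "k2 > 0"
  shows "positive_fixed_point (bertrand_map \<alpha> c k1 k2) p \<longleftrightarrow>
    0 < p $ 1 \<and> 0 < p $ 2 \<and>
    bertrand_marginal \<alpha> c (p $ 1) (p $ 2) = 0 \<and> bertrand_marginal \<alpha> c (p $ 2) (p $ 1) = 0"
  using assms by (auto simp: positive_fixed_point_def bertrand_map_def vec_eq_iff forall_2)

lemma bertrand_marginal_half:
  assumes "p > 0" "q > 0"
  shows "bertrand_marginal (1/2) c p q = 0 \<longleftrightarrow> p\<^sup>2 = (q + 2 * p) * c"
proof -
  have b: "bertrand_beta (1/2) = 1" by (simp add: bertrand_beta_def)
  have "p\<^sup>2 * (p + q)\<^sup>2 \<noteq> 0" using assms by simp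
  then have "bertrand_marginal (1/2) c p q = 0 \<longleftrightarrow> - q * p\<^sup>2 + (q\<^sup>2 + 2 * p * q) * c = 0"
    using assms by (simp add: bertrand_marginal_def b Let_def)
  also have "\<dots> \<longleftrightarrow> q * ((q + 2 * p) * c - p\<^sup>2) = 0"
    by (simp add: algebra_simps power2_eq_square)
  finally show ?thesis using assms by auto
qed

lemma bertrand_marginal_third:
  assumes "x > 0" "y > 0"
  shows "bertrand_marginal (1/3) c (x\<^sup>2) (y\<^sup>2) = 0 \<longleftrightarrow> x ^ 3 = (2 * y + 3 * x) * c"
proof -
  have b: "bertrand_beta (1/3) = 1/2" by (simp add: bertrand_beta_def)
  have r: "(z\<^sup>2) powr (1/2) = z" "(z\<^sup>2) powr (3/2) = z ^ 3" if "z > 0" for z :: real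
    using that by (simp_all add: powr_powr flip: powr_numeral)
  have "(x\<^sup>2)\<^sup>2 * (x + y)\<^sup>2 \<noteq> 0" using assms by simp
  then have "bertrand_marginal (1/3) c (x\<^sup>2) (y\<^sup>2) = 0 \<longleftrightarrow>
      - (1/2) * y * x ^ 3 + (y\<^sup>2 + (3/2) * x * y) * c = 0"
    using assms by (simp add: bertrand_marginal_def b Let_def r)
  also have "\<dots> \<longleftrightarrow> y * ((2 * y + 3 * x) * c - x ^ 3) = 0"
    by (simp add: algebra_simps power2_eq_square)
  finally show ?thesis using assms by auto
qed

lemma bertrand_equilibrium_half:
  assumes "c > 0" "k1 > 0" "k2 > 0"
  shows "bertrand_equilibrium (1/2) c k1 k2 = vector [3 * c, 3 * c]"
  unfolding bertrand_equilibrium_def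
proof (rule the_equality)
  show "positive_fixed_point (bertrand_map (1/2) c k1 k2) (vector [3 * c, 3 * c])"
    using assms by (simp add: positive_fixed_point_iff bertrand_marginal_half power2_eq_square)
next
  fix p assume "positive_fixed_point (bertrand_map (1/2) c k1 k2) p"
  moreover define x y where "x = p $ 1" and "y = p $ 2"
  ultimately have pos: "x > 0" "y > 0"
    and e: "x\<^sup>2 = (y + 2 * x) * c" "y\<^sup>2 = (x + 2 * y) * c"
    using assms bertrand_marginal_half by (auto simp: positive_fixed_point_iff)
  have "(x - y) * (x + y - c) = 0"
    using e by (simp add: algebra_simps power2_eq_square)
  moreover have "x * (x - 2 * c) > 0"
    using e pos assms by (simp add: algebra_simps power2_eq_square)
  then have "x > 2 * c" using pos by (simp add: zero_less_mult_iff)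
  ultimately have "x = y" using pos assms by auto
  moreover from this have "x * (x - 3 * c) = 0"
    using e by (simp add: algebra_simps power2_eq_square)
  ultimately show "p = vector [3 * c, 3 * c]"
    using pos by (simp add: vec_eq_iff forall_2 x_def y_def)
qed

lemma bertrand_equilibrium_third:
  assumes "c > 0" "k1 > 0" "k2 > 0"
  shows "bertrand_equilibrium (1/3) c k1 k2 = vector [5 * c, 5 * c]"
  unfolding bertrand_equilibrium_def
proof (rule the_equality)
  have "sqrt (5 * c) ^ 3 = 5 * c * sqrt (5 * c)"
    using assms by (simp add: power3_eq_cube)
  then have "bertrand_marginal (1/3) c (5 * c) (5 * c) = 0"
    using bertrand_marginal_third[of "sqrt (5 * c)" "sqrt (5 * c)" c] assms by simp
  then show "positive_fixed_point (bertrand_map (1/3) c k1 k2) (vector [5 * c, 5 * c])"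
    using assms by (simp add: positive_fixed_point_iff)
next
  fix p assume "positive_fixed_point (bertrand_map (1/3) c k1 k2) p"
  then have p: "0 < p $ 1" "0 < p $ 2" "bertrand_marginal (1/3) c (p $ 1) (p $ 2) = 0"
    "bertrand_marginal (1/3) c (p $ 2) (p $ 1) = 0"
    using assms by (simp_all add: positive_fixed_point_iff)
  define x y where "x = sqrt (p $ 1)" and "y = sqrt (p $ 2)"
  have pos: "x > 0" "y > 0" and sq: "p $ 1 = x\<^sup>2" "p $ 2 = y\<^sup>2"
    using p by (simp_all add: x_def y_def)
  have e: "x ^ 3 = (2 * y + 3 * x) * c" "y ^ 3 = (2 * x + 3 * y) * c"
    using p(3,4) pos bertrand_marginal_third unfolding sq by auto
  have "(x - y) * (x\<^sup>2 + x * y + y\<^sup>2 - c) = x ^ 3 - y ^ 3 - (x - y) * c"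
    by (simp add: algebra_simps power2_eq_square power3_eq_cube)
  also have "\<dots> = 0" using e by (simp add: algebra_simps)
  finally have "(x - y) * (x\<^sup>2 + x * y + y\<^sup>2 - c) = 0" .
  moreover have "x * (x\<^sup>2 - 3 * c) > 0"
    using e pos assms by (simp add: algebra_simps power2_eq_square power3_eq_cube)
  then have "x\<^sup>2 > 3 * c" using pos by (simp add: zero_less_mult_iff)
  then have "x\<^sup>2 + x * y + y\<^sup>2 > c"
    using pos assms by (smt (verit) mult_pos_pos zero_less_power)
  ultimately have "x = y" by auto
  moreover from this have "x * (x\<^sup>2 - 5 * c) = 0"
    using e by (simp add: algebra_simps power2_eq_square power3_eq_cube)
  ultimately show "p = vector [5 * c, 5 * c]"
    using pos by (simp add: vec_eq_iff forall_2 sq)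
qed

end

(* At the symmetric equilibrium (t, t), with beta t = (2 + beta) c, the Jacobian has the form
   [[1 - m x, x], [y, 1 - m y]] with m = 2 (1 + beta) / beta and x, y proportional to k1, k2.
   For alpha = 1/2 its smaller eigenvalue is at most 1 - m (x + y) / 2, so stability forces
   k1 + k2 < 108 c^2; for alpha = 1/3 the Gershgorin discs lie in the open unit disc as soon as
   6 k1, 6 k2 <= 1000 c^2. *)
theory Submission
  imports Defs
begin

section \<open>Derivative of the adjustment direction at the symmetric equilibrium\<close>

lemma has_derivative_powr_nth:
  fixes a :: "real^'n"
  assumes "a $ i > 0"
  shows "((\<lambda>p. (p $ i) powr b) has_derivative (\<lambda>h. b * (a $ i) powr (b - 1) * h $ i)) (at a)"
proof -
  have "((\<lambda>p. p $ i) has_derivative (\<lambda>h. h $ i)) (at a)"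
    by (intro bounded_linear_imp_has_derivative bounded_linear_vec_nth)
  moreover have "((\<lambda>x. x powr b) has_derivative (\<lambda>h. b * (a $ i) powr (b - 1) * h)) (at (a $ i))"
    using has_real_derivative_powr[OF assms, of b] by (simp add: has_field_derivative_def)
  ultimately show ?thesis
    using diff_chain_at[of "\<lambda>p. p $ i"] by (fastforce simp: o_def)
qed

text \<open>At a zero of the numerator the quotient-rule term containing \<open>g'\<close> vanishes,
  so the derivative of the denominator has to exist but never has to be computed.\<close>

lemma has_derivative_divide_zero:
  fixes f g :: "'a::real_normed_vector \<Rightarrow> real"
  assumes "(f has_derivative f') (at a)" "(g has_derivative g') (at a)" "f a = 0" "g a \<noteq> 0"
  shows "((\<lambda>x. f x / g x) has_derivative (\<lambda>h. f' h / g a)) (at a)"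
  by (rule has_derivative_eq_rhs[OF has_derivative_divide'[OF assms(1,2,4)]])
     (simp add: assms fun_eq_iff)

text \<open>The equation \<open>\<beta> * t = (2 + \<beta>) * c\<close> says that the numerator
  vanishes at equal prices \<open>t\<close>, so only the numerator is differentiated. Leaving
  \<open>i\<close> and \<open>j\<close> free serves both firms at once.\<close>

lemma bertrand_marginal_has_derivative:
  fixes a :: "real^2"
  assumes \<beta>: "\<beta> = bertrand_beta \<alpha>" "\<beta> > 0" and t: "t > 0" "\<beta> * t = (2 + \<beta>) * c"
    and a: "a $ i = t" "a $ j = t"
  shows "((\<lambda>p. bertrand_marginal \<alpha> c (p $ i) (p $ j)) has_derivative
    (\<lambda>h. c * \<beta> / (4 * t ^ 3) * (h $ j - 2 * (1 + \<beta>) / \<beta> * h $ i))) (at a)"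
proof -
  \<comment> \<open>Every power occurring at the equilibrium becomes a monomial in \<open>t\<close>
    and \<open>u\<close>, possibly divided by \<open>t\<close>; the factor \<open>u\<^sup>2\<close>
    finally cancels against \<open>D a\<close>.\<close>
  define u where "u = t powr \<beta>"
  have u: "u > 0" using t by (simp add: u_def)
  have pw: "t powr \<beta> = u" "t powr (2 * \<beta>) = u\<^sup>2" "t powr (1 + \<beta>) = t * u"
    "t powr (\<beta> - 1) = u / t" "t powr (2 * \<beta> - 1) = u\<^sup>2 / t" "t powr (1 + \<beta> - 1) = u"
    using t(1) powr_add[of t \<beta> \<beta>]
    by (simp_all add: u_def powr_add[of t 1] powr_diff power2_eq_square)
  define N where "N = (\<lambda>p :: real^2. - \<beta> * (p $ j) powr \<beta> * (p $ i) powr (1 + \<beta>)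
    + ((p $ j) powr (2 * \<beta>) + (1 + \<beta>) * (p $ i) powr \<beta> * (p $ j) powr \<beta>) * c)"
  define D where "D = (\<lambda>p :: real^2. (p $ i)\<^sup>2 * ((p $ i) powr \<beta> + (p $ j) powr \<beta>)\<^sup>2)"
  note der = has_derivative_powr_nth[of a i, unfolded a, OF t(1)]
    has_derivative_powr_nth[of a j, unfolded a, OF t(1)]
  have Da: "D a = 4 * t\<^sup>2 * u\<^sup>2"
    unfolding D_def a pw by (simp add: power2_eq_square)
  have "N a = u\<^sup>2 * ((2 + \<beta>) * c - \<beta> * t)"
    unfolding N_def a pw by (simp add: power2_eq_square algebra_simps)
  then have Na: "N a = 0" using t by simp
  \<comment> \<open>Mere differentiability suffices here, since \<open>N a = 0\<close>.\<close>
  have "D differentiable (at a)"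
    unfolding D_def
    by (intro differentiable_mult differentiable_power differentiable_add
        differentiableI[OF der(1)] differentiableI[OF der(2)]
        bounded_linear_imp_differentiable bounded_linear_vec_nth)
  then obtain D' where D': "(D has_derivative D') (at a)"
    unfolding differentiable_def by blast
  have "(N has_derivative (\<lambda>h. c * \<beta> * u\<^sup>2 / t * (h $ j - 2 * (1 + \<beta>) / \<beta> * h $ i))) (at a)"
  proof -
    have *: "(N has_derivative (\<lambda>h.
        - \<beta> * (\<beta> * (u / t) * h $ j * (t * u) + u * ((1 + \<beta>) * u * h $ i))
        + (2 * \<beta> * (u\<^sup>2 / t) * h $ j
           + (1 + \<beta>) * (\<beta> * (u / t) * h $ i * u + u * (\<beta> * (u / t) * h $ j))) * c)) (at a)"
      unfolding N_def
      by (rule has_derivative_eq_rhs,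
          (rule der has_derivative_add has_derivative_mult_right has_derivative_mult_left
            has_derivative_mult)+)
         (unfold a pw, simp add: algebra_simps fun_eq_iff)
    show ?thesis
    proof (rule has_derivative_eq_rhs[OF *], rule ext)
      fix h :: "real^2"
      \<comment> \<open>The terms are grouped so that \<open>\<beta> * t\<close> stands alone and
        the equilibrium equation can replace it by \<open>(2 + \<beta>) * c\<close>.\<close>
      have "- \<beta> * (\<beta> * (u / t) * h $ j * (t * u) + u * ((1 + \<beta>) * u * h $ i))
        + (2 * \<beta> * (u\<^sup>2 / t) * h $ j
           + (1 + \<beta>) * (\<beta> * (u / t) * h $ i * u + u * (\<beta> * (u / t) * h $ j))) * c
        = u\<^sup>2 / t * (- (\<beta> * t) * (\<beta> * h $ j + (1 + \<beta>) * h $ i)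
           + \<beta> * c * ((3 + \<beta>) * h $ j + (1 + \<beta>) * h $ i))"
        using t(1) by (simp add: field_simps power2_eq_square)
      also have "\<dots> = c * \<beta> * u\<^sup>2 / t * (h $ j - 2 * (1 + \<beta>) / \<beta> * h $ i)"
        unfolding t(2) using t(1) \<beta>(2) by (simp add: field_simps)
      finally show "- \<beta> * (\<beta> * (u / t) * h $ j * (t * u) + u * ((1 + \<beta>) * u * h $ i))
        + (2 * \<beta> * (u\<^sup>2 / t) * h $ j
           + (1 + \<beta>) * (\<beta> * (u / t) * h $ i * u + u * (\<beta> * (u / t) * h $ j))) * c
        = c * \<beta> * u\<^sup>2 / t * (h $ j - 2 * (1 + \<beta>) / \<beta> * h $ i)" .
    qed
  qed
  then have "((\<lambda>p. N p / D p) has_derivative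
      (\<lambda>h. c * \<beta> * u\<^sup>2 / t * (h $ j - 2 * (1 + \<beta>) / \<beta> * h $ i) / D a)) (at a)"
    using D' Na by (rule has_derivative_divide_zero) (use Da t u in simp)
  moreover have "(\<lambda>h. c * \<beta> * u\<^sup>2 / t * (h $ j - 2 * (1 + \<beta>) / \<beta> * h $ i) / D a) =
      (\<lambda>h. c * \<beta> / (4 * t ^ 3) * (h $ j - 2 * (1 + \<beta>) / \<beta> * h $ i))"
    unfolding Da using t(1) u by (simp add: fun_eq_iff power2_eq_square power3_eq_cube mult_ac)
  moreover have "(\<lambda>p. bertrand_marginal \<alpha> c (p $ i) (p $ j)) = (\<lambda>p. N p / D p)"
    by (simp add: bertrand_marginal_def N_def D_def Let_def \<beta>(1) fun_eq_iff)
  ultimately show ?thesis by simp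
qed

section \<open>The Jacobian at the equilibrium and its eigenvalues\<close>

definition adjustment_matrix :: "real \<Rightarrow> real \<Rightarrow> real \<Rightarrow> real^2^2" where
  "adjustment_matrix m x y = vector [vector [1 - m * x, x], vector [y, 1 - m * y]]"

text \<open>The own-price derivative is -m times the cross-price derivative, and by symmetry the
  cross-price derivative is the same for both firms, so only the speeds \<open>k1\<close> and
  \<open>k2\<close> distinguish the rows. Uniqueness of the Frechet derivative then identifies the
  matrix.\<close>

lemma jacobian_bertrand_map:
  assumes \<beta>: "\<beta> = bertrand_beta \<alpha>" "\<beta> > 0" and t: "t > 0" "\<beta> * t = (2 + \<beta>) * c"
  shows "jacobian (bertrand_map \<alpha> c k1 k2) (at (vector [t, t])) =
    adjustment_matrix (2 * (1 + \<beta>) / \<beta>)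
      (k1 * (c * \<beta> / (4 * t ^ 3))) (k2 * (c * \<beta> / (4 * t ^ 3)))"
    (is "jacobian ?F (at ?a) = ?A")
proof -
  define m e where me: "m = 2 * (1 + \<beta>) / \<beta>" "e = c * \<beta> / (4 * t ^ 3)"
  note der = bertrand_marginal_has_derivative[OF \<beta> t, of ?a, folded me]
  have nth: "((\<lambda>p :: real^2. p $ i) has_derivative (\<lambda>h. h $ i)) (at ?a)" for i
    by (intro bounded_linear_imp_has_derivative bounded_linear_vec_nth)
  have "((\<lambda>p. ?F p $ 1) has_derivative (\<lambda>h. (?A *v h) $ 1)) (at ?a)"
    unfolding bertrand_map_def vector_2 me[symmetric]
    by (rule has_derivative_eq_rhs, rule has_derivative_add[OF nth],
        rule has_derivative_mult_right[OF der])
       (simp_all add: adjustment_matrix_def matrix_vector_mult_def sum_2 fun_eq_iff algebra_simps)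
  moreover have "((\<lambda>p. ?F p $ 2) has_derivative (\<lambda>h. (?A *v h) $ 2)) (at ?a)"
    unfolding bertrand_map_def vector_2 me[symmetric]
    by (rule has_derivative_eq_rhs, rule has_derivative_add[OF nth],
        rule has_derivative_mult_right[OF der])
       (simp_all add: adjustment_matrix_def matrix_vector_mult_def sum_2 fun_eq_iff algebra_simps)
  ultimately have "((\<lambda>p. ?F p $ i) has_derivative (\<lambda>h. (?A *v h) $ i)) (at ?a)" for i
    using exhaust_2[of i] by auto
  then have "(?F has_derivative (\<lambda>h. ?A *v h)) (at ?a)"
    by (subst has_derivative_componentwise_within)
       (auto simp: Basis_vec_def inner_axis)
  then have "frechet_derivative ?F (at ?a) = (\<lambda>h. ?A *v h)"
    by (metis frechet_derivative_at)
  then show ?thesis by (simp add: jacobian_def)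
qed

lemma is_eigenvalue_adjustment_matrix_iff:
  "is_eigenvalue (map_matrix complex_of_real (adjustment_matrix m x y)) \<mu> \<longleftrightarrow>
    (\<exists>v w. (v \<noteq> 0 \<or> w \<noteq> 0) \<and>
      complex_of_real (1 - m * x) * v + complex_of_real x * w = \<mu> * v \<and>
      complex_of_real y * v + complex_of_real (1 - m * y) * w = \<mu> * w)"
    (is "_ \<longleftrightarrow> (\<exists>v w. ?P v w)")
proof -
  have "is_eigenvalue (map_matrix complex_of_real (adjustment_matrix m x y)) \<mu> \<longleftrightarrow>
      (\<exists>v :: complex^2. ?P (v $ 1) (v $ 2))"
    by (simp add: is_eigenvalue_def adjustment_matrix_def vec_eq_iff forall_2
        matrix_vector_mult_def sum_2 map_matrix_def)
  also have "\<dots> \<longleftrightarrow> (\<exists>v w. ?P v w)"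
    by (metis vector_2)
  finally show ?thesis .
qed

text \<open>The characteristic polynomial has the positive discriminant
  \<open>m\<^sup>2 * (x - y)\<^sup>2 + 4 * x * y\<close>, so its roots are real, and the smaller one
  is at most half the trace.\<close>

lemma adjustment_matrix_eigenvalue_le:
  assumes "x > 0" "y > 0"
  obtains \<mu> where "is_eigenvalue (map_matrix complex_of_real (adjustment_matrix m x y))
      (complex_of_real \<mu>)" "\<mu> \<le> 1 - m * (x + y) / 2"
proof -
  define d where "d = sqrt (m\<^sup>2 * (x - y)\<^sup>2 + 4 * x * y)"
  have d: "d\<^sup>2 = m\<^sup>2 * (x - y)\<^sup>2 + 4 * x * y" "d \<ge> 0"
    using assms by (simp_all add: d_def)
  \<comment> \<open>\<open>1 - l\<close> is the smaller root of the characteristic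
    polynomial.\<close>
  define l where "l = (m * (x + y) + d) / 2"
  have "2 * l - m * (x + y) = d" by (simp add: l_def field_simps)
  then have "(2 * l - m * (x + y))\<^sup>2 = m\<^sup>2 * (x - y)\<^sup>2 + 4 * x * y"
    using d by simp
  \<comment> \<open>This is the second row of the eigenvector equation for
    \<open>(x, m * x - l)\<close>; the first row is an identity in \<open>l\<close>.\<close>
  then have l: "y * x + (1 - m * y) * (m * x - l) = (1 - l) * (m * x - l)"
    by (simp add: power2_eq_square algebra_simps)
  have "is_eigenvalue (map_matrix complex_of_real (adjustment_matrix m x y))
      (complex_of_real (1 - l))"
    unfolding is_eigenvalue_adjustment_matrix_iff
  proof (intro exI conjI)
    show "complex_of_real x \<noteq> 0 \<or> complex_of_real (m * x - l) \<noteq> 0" using assms by simp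
    show "complex_of_real (1 - m * x) * complex_of_real x
        + complex_of_real x * complex_of_real (m * x - l)
        = complex_of_real (1 - l) * complex_of_real x"
      by (simp add: algebra_simps)
    show "complex_of_real y * complex_of_real x
        + complex_of_real (1 - m * y) * complex_of_real (m * x - l)
        = complex_of_real (1 - l) * complex_of_real (m * x - l)"
      using arg_cong[OF l, of complex_of_real] by (simp only: of_real_add of_real_mult)
  qed
  moreover have "1 - l \<le> 1 - m * (x + y) / 2"
    using d by (simp add: l_def field_simps)
  ultimately show ?thesis using that by blast
qed

text \<open>Gershgorin's estimate in the row of a dominant eigenvector entry:
  \<open>m * x \<le> 1\<close> keeps the diagonal entry nonnegative, and \<open>m > 1\<close> makes
  the radius \<open>x\<close> smaller than its distance \<open>m * x\<close> from 1.\<close>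

lemma gershgorin_row:
  fixes v w \<mu> :: complex
  assumes "v \<noteq> 0" "cmod w \<le> cmod v"
    and "complex_of_real (1 - m * x) * v + complex_of_real x * w = \<mu> * v"
    and "x > 0" "m > 1" "m * x \<le> 1"
  shows "cmod \<mu> < 1"
proof -
  have "cmod \<mu> * cmod v \<le> (1 - m * x) * cmod v + x * cmod w"
    using norm_triangle_ineq[of "complex_of_real (1 - m * x) * v" "complex_of_real x * w"] assms
    by (simp add: norm_mult del: of_real_diff of_real_mult)
  also have "\<dots> \<le> (1 - m * x) * cmod v + x * cmod v"
    using assms by (simp add: mult_left_mono)
  also have "\<dots> = (1 - (m - 1) * x) * cmod v" by (simp add: algebra_simps)
  finally have "cmod \<mu> \<le> 1 - (m - 1) * x" using assms by simp
  moreover have "(m - 1) * x > 0" using assms by simp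
  ultimately show ?thesis by linarith
qed

lemma adjustment_matrix_eigenvalue_less_1:
  assumes "is_eigenvalue (map_matrix complex_of_real (adjustment_matrix m x y)) \<mu>"
    and "m > 1" "x > 0" "y > 0" "m * x \<le> 1" "m * y \<le> 1"
  shows "cmod \<mu> < 1"
proof -
  \<comment> \<open>The second row is stated with its diagonal term first, so that
    \<open>gershgorin_row\<close> applies to it with \<open>v\<close> and \<open>w\<close>
    exchanged.\<close>
  obtain v w where vw: "v \<noteq> 0 \<or> w \<noteq> 0"
      "complex_of_real (1 - m * x) * v + complex_of_real x * w = \<mu> * v"
      "complex_of_real (1 - m * y) * w + complex_of_real y * v = \<mu> * w"
    using assms(1) unfolding is_eigenvalue_adjustment_matrix_iff by (metis add.commute)
  show ?thesis
  proof (cases "cmod w \<le> cmod v")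
    case True
    then have "v \<noteq> 0" using vw(1) by auto
    from gershgorin_row[OF this True vw(2)] assms show ?thesis by simp
  next
    case False
    then have "w \<noteq> 0" "cmod v \<le> cmod w" by auto
    from gershgorin_row[OF this vw(3)] assms show ?thesis by simp
  qed
qed

section \<open>Comparison of the two stability regions\<close>

lemma jacobian_half:
  assumes "c > 0"
  shows "jacobian (bertrand_map (1/2) c k1 k2) (at (vector [3 * c, 3 * c])) =
    adjustment_matrix 4 (k1 / (108 * c\<^sup>2)) (k2 / (108 * c\<^sup>2))"
  \<comment> \<open>With \<beta> = 1 and t = 3c, the ratio is m = 4 and the scale is c / (4 * 27
    c^3).\<close>
  using jacobian_bertrand_map[of 1 "1/2" "3 * c" c k1 k2] assms
  by (simp add: bertrand_beta_def power2_eq_square power3_eq_cube)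

lemma jacobian_third:
  assumes "c > 0"
  shows "jacobian (bertrand_map (1/3) c k1 k2) (at (vector [5 * c, 5 * c])) =
    adjustment_matrix 6 (k1 / (1000 * c\<^sup>2)) (k2 / (1000 * c\<^sup>2))"
  \<comment> \<open>With \<beta> = 1/2 and t = 5c, the ratio is m = 6 and the scale is (c/2) / (4 *
    125 c^3).\<close>
  using jacobian_bertrand_map[of "1/2" "1/3" "5 * c" c k1 k2] assms
  by (simp add: bertrand_beta_def power2_eq_square power3_eq_cube)

lemma stability_region_half_bound:
  assumes "(c, k1, k2) \<in> stability_region (1/2)"
  shows "k1 + k2 < 108 * c\<^sup>2"
proof -
  have pos: "c > 0" "k1 > 0" "k2 > 0"
    and st: "locally_stable (bertrand_map (1/2) c k1 k2) (vector [3 * c, 3 * c])"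
    using assms by (auto simp: stability_region_def bertrand_equilibrium_half)
  obtain \<mu> where \<mu>: "is_eigenvalue (map_matrix complex_of_real
        (adjustment_matrix 4 (k1 / (108 * c\<^sup>2)) (k2 / (108 * c\<^sup>2)))) (complex_of_real \<mu>)"
      "\<mu> \<le> 1 - 4 * (k1 / (108 * c\<^sup>2) + k2 / (108 * c\<^sup>2)) / 2"
    using adjustment_matrix_eigenvalue_le[of "k1 / (108 * c\<^sup>2)" "k2 / (108 * c\<^sup>2)" 4] pos by auto
  have "\<bar>\<mu>\<bar> < 1"
    using st \<mu>(1) unfolding locally_stable_def jacobian_half[OF pos(1)] by fastforce
  \<comment> \<open>The lower bound \<open>\<mu> > -1\<close> is combined with the upper bound on
    \<open>\<mu>\<close>.\<close>
  then have "4 * (k1 / (108 * c\<^sup>2) + k2 / (108 * c\<^sup>2)) / 2 < 2" using \<mu>(2) by linarith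
  then show ?thesis using pos by (simp add: field_simps)
qed

lemma stability_region_thirdI:
  assumes "c > 0" "k1 > 0" "k2 > 0" "6 * k1 \<le> 1000 * c\<^sup>2" "6 * k2 \<le> 1000 * c\<^sup>2"
  shows "(c, k1, k2) \<in> stability_region (1/3)"
proof -
  have "cmod \<mu> < 1" if "is_eigenvalue (map_matrix complex_of_real
      (adjustment_matrix 6 (k1 / (1000 * c\<^sup>2)) (k2 / (1000 * c\<^sup>2)))) \<mu>" for \<mu>
    using adjustment_matrix_eigenvalue_less_1[OF that] assms by (simp add: field_simps)
  then show ?thesis
    using assms by (simp add: stability_region_def bertrand_equilibrium_third
        locally_stable_def jacobian_third)
qed

theorem proposition5:
  shows "stability_region (1/2) \<subset> stability_region (1/3)"
proof
  show "stability_region (1/2) \<subseteq> stability_region (1/3)"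
  proof clarify
    fix c k1 k2 assume s: "(c, k1, k2) \<in> stability_region (1/2)"
    then have pos: "c > 0" "k1 > 0" "k2 > 0" by (auto simp: stability_region_def)
    \<comment> \<open>Each speed is below 108 c^2, so six times it is below 648 c^2, which is at
      most 1000 c^2 once c^2 is known to be nonnegative.\<close>
    have "0 \<le> c\<^sup>2" by simp
    then have "6 * k1 \<le> 1000 * c\<^sup>2" "6 * k2 \<le> 1000 * c\<^sup>2"
      using stability_region_half_bound[OF s] pos by linarith+
    then show "(c, k1, k2) \<in> stability_region (1/3)"
      using pos by (intro stability_region_thirdI)
  qed
  \<comment> \<open>The witness has k1 + k2 = 108 c^2 exactly, which the strict bound for \<alpha> =
    1/2 excludes, while 6 * 54 = 324 is well below 1000.\<close>
  have "(1, 54, 54) \<in> stability_region (1/3)" by (rule stability_region_thirdI) auto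
  moreover have "(1, 54, 54) \<notin> stability_region (1/2)"
    using stability_region_half_bound[of 1 54 54] by auto
  ultimately show "stability_region (1/2) \<noteq> stability_region (1/3)" by blast
qed

end
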